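(* For $\sigma=3$ and every $k\ge4$, no $(k,3)$-PdB-string exists.
   Context: Let $\Sigma=\{a_1<\dots<a_\sigma\}$. For a string $u$, $\mathbf{pv}(u)\in\mathbb{N}^\sigma$ has $i$-th entry the number of occurrences of $a_i$ in $u$; the order of a Parikh vector is the sum of its entries. A string $w$ over $\Sigma$ is a $(k,\sigma)$-PdB-string if for every Parikh vector $p\in\mathbb{N}^\sigma$ of order $k$ there is exactly one (occurrence of a) length-$k$ substring $u$ of $w$ with $\mathbf{pv}(u)=p$. *)

theory Defs
  imports Main
begin

definition parikh_vector :: "'a::linorder set \<Rightarrow> 'a list \<Rightarrow> nat list" where
  "parikh_vector \<Sigma> u = map (count_list u) (sorted_list_of_set \<Sigma>)"

text \<open>Vectors with \<open>card \<Sigma>\<close> natural entries are lists of that length; the order of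
  such a vector is its \<^const>\<open>sum_list\<close>. An occurrence of a length-\<open>k\<close> substring is
  identified with its starting position \<open>i\<close>, so equal substrings at different positions
  count separately.\<close>

definition PdB_string :: "nat \<Rightarrow> 'a::linorder set \<Rightarrow> 'a list \<Rightarrow> bool" where
  "PdB_string k \<Sigma> w \<longleftrightarrow>
     set w \<subseteq> \<Sigma> \<and>
     (\<forall>p. length p = card \<Sigma> \<and> sum_list p = k \<longrightarrow>
        (\<exists>!i. i + k \<le> length w \<and> parikh_vector \<Sigma> (take k (drop i w)) = p))"

end

theory Submission
  imports Defs
begin

text \<open>
  Identify the length-\<open>k\<close> windows of \<open>w\<close> with the points of the triangular grid of Parikh vectors
  of order \<open>k\<close>; sliding the window yields a walk that visits every point exactly once. Hence
  \<open>w ! p \<noteq> w ! (p + k)\<close>, and before and after the visit of a corner \<open>x\<^sup>k\<close> the walk moves monotonically,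
  for \<open>k\<close> steps, between that corner and the opposite side. Let the corners be visited in the order
  \<open>a\<^sup>k\<close>, \<open>b\<^sup>k\<close>, \<open>c\<^sup>k\<close>. The arm leaving \<open>a\<^sup>k\<close> and the arm entering \<open>c\<^sup>k\<close> cross, so they
  share a point in time, which forces \<open>w\<close> to contain the factor \<open>a\<^sup>k b\<^sup>k c\<^sup>k\<close>. This factor already
  visits the sides \<open>ab\<close> and \<open>bc\<close> completely, so neither the arm entering \<open>a\<^sup>k\<close> nor the one leaving
  \<open>c\<^sup>k\<close> can be complete: fewer than \<open>k\<close> letters precede and follow the factor. The two incomplete
  arms cannot visit all four points with \<open>a\<close>- and \<open>c\<close>-entries in \<open>{1, 2}\<close>.
\<close>

section \<open>Window counts and crossing of monotone functions\<close>

lemma count_list_window_Suc: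
  assumes "p + k < length w"
  shows "count_list (take k (drop (Suc p) w)) x + of_bool (w ! p = x)
       = count_list (take k (drop p w)) x + of_bool (w ! (p + k) = x)"
proof -
  \<comment> \<open>Both windows lie in one factor of length \<open>Suc k\<close>, split off at
    either end.\<close>
  have "take (Suc k) (drop p w) = w ! p # take k (drop (Suc p) w)"
    using assms by (simp add: Cons_nth_drop_Suc [symmetric])
  moreover have "take (Suc k) (drop p w) = take k (drop p w) @ [w ! (p + k)]"
    using assms by (simp add: take_Suc_conv_app_nth)
  ultimately have "count_list (w ! p # take k (drop (Suc p) w)) x
      = count_list (take k (drop p w) @ [w ! (p + k)]) x"
    by simp
  then show ?thesis
    by (auto split: if_splits)
qed

lemma count_list_eq_length_iff: "count_list xs x = length xs \<longleftrightarrow> set xs \<subseteq> {x}"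
proof (induction xs)
  case (Cons y ys)
  then show ?case
    using count_le_length [of ys x] by auto
qed simp

text \<open>If \<open>B t\<close> and \<open>D s\<close> are the \<open>b\<close>-entries \<open>t\<close> steps after leaving the corner \<open>a\<^sup>k\<close> and \<open>s\<close> steps
  before reaching the corner \<open>c\<^sup>k\<close>, the conclusion says that the two arms meet.\<close>

lemma monotone_arms_cross:
  fixes B D :: "nat \<Rightarrow> nat"
  assumes B0: "B 0 = 0" and D0: "D 0 = 0"
    and B: "\<And>t. t < k \<Longrightarrow> B (Suc t) = B t \<or> B (Suc t) = Suc (B t)"
    and D: "\<And>s. s < k \<Longrightarrow> D (Suc s) = D s \<or> D (Suc s) = Suc (D s)"
  obtains t where "t \<le> k" "B t \<le> t" "D (k + B t - t) = B t"
proof -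
  have B_le: "B t \<le> t" if "t \<le> k" for t
    using that
  proof (induction t)
    case (Suc t)
    then show ?case using B [of t] by auto
  qed (simp add: B0)
  have D_le: "D s \<le> s" if "s \<le> k" for s
    using that
  proof (induction s)
    case (Suc s)
    then show ?case using D [of s] by auto
  qed (simp add: D0)
  \<comment> \<open>A discrete intermediate value argument: from \<open>t\<close> to
    \<open>Suc t\<close> either \<open>B\<close> grows and the argument of \<open>D\<close> stays,
    or \<open>B\<close> stays and that argument drops by one. So the gap closes by at most one per
    step and is zero when the inequality first holds.\<close>
  define t where "t = (LEAST t. D (k + B t - t) \<le> B t)"
  have k: "D (k + B k - k) \<le> B k"
    using B_le D_le by simp
  have le: "D (k + B t - t) \<le> B t"
    unfolding t_def by (rule LeastI [where P = "\<lambda>t. D (k + B t - t) \<le> B t", OF k])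
  have "t \<le> k"
    unfolding t_def by (rule Least_le [where P = "\<lambda>t. D (k + B t - t) \<le> B t", OF k])
  moreover have "D (k + B t - t) = B t"
  proof (cases t)
    case 0
    then show ?thesis using le B0 by simp
  next
    case (Suc r)
    then have gt: "B r < D (k + B r - r)"
      using not_less_Least [of r "\<lambda>t. D (k + B t - t) \<le> B t"] by (simp add: t_def not_le)
    have r: "r < k" "B r \<le> r"
      using Suc \<open>t \<le> k\<close> B_le by auto
    from B [OF r(1)] show ?thesis
    proof
      assume "B (Suc r) = B r"
      moreover have "k + B r - r = Suc (k + B r - Suc r)"
        using r by simp
      moreover have "k + B r - Suc r < k"
        using r by simp
      ultimately show ?thesis
        using D [of "k + B r - Suc r"] gt le Suc by auto
    next
      assume "B (Suc r) = Suc (B r)"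
      then show ?thesis
        using gt le Suc by simp
    qed
  qed
  ultimately show thesis
    using that B_le by blast
qed

section \<open>The walk through the grid of Parikh vectors\<close>

locale parikh_de_bruijn_string =
  fixes \<Sigma> :: "'a::linorder set" and k :: nat and w :: "'a list"
  assumes finite_alphabet: "finite \<Sigma>"
    and PdB: "PdB_string k \<Sigma> w"
begin

definition occ :: "'a \<Rightarrow> nat \<Rightarrow> nat" where
  "occ x p = count_list (take k (drop p w)) x"

lemma sum_occ:
  assumes "p + k \<le> length w"
  shows "(\<Sum>x\<in>\<Sigma>. occ x p) = k"
proof -
  have "set w \<subseteq> \<Sigma>"
    using PdB by (simp add: PdB_string_def)
  then have "(\<Sum>x\<in>\<Sigma>. occ x p) = length (take k (drop p w))"
    unfolding occ_def using finite_alphabet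
    by (intro sum_count_set) (auto dest: in_set_takeD in_set_dropD)
  then show ?thesis
    using assms by simp
qed

lemma occ_inj:
  assumes "p + k \<le> length w" "q + k \<le> length w" and "\<And>x. x \<in> \<Sigma> \<Longrightarrow> occ x p = occ x q"
  shows "p = q"
proof -
  let ?v = "parikh_vector \<Sigma> (take k (drop p w))"
  have eq: "parikh_vector \<Sigma> (take k (drop q w)) = ?v"
    using assms(3) finite_alphabet by (auto simp: parikh_vector_def occ_def)
  have "sum_list ?v = (\<Sum>x\<in>\<Sigma>. occ x p)"
    using finite_alphabet
    by (simp add: parikh_vector_def occ_def sum_list_distinct_conv_sum_set)
  also have "\<dots> = k"
    using assms(1) by (rule sum_occ)
  finally have "length ?v = card \<Sigma> \<and> sum_list ?v = k"
    by (simp add: parikh_vector_def)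
  then have "\<exists>!i. i + k \<le> length w \<and> parikh_vector \<Sigma> (take k (drop i w)) = ?v"
    using PdB unfolding PdB_string_def by blast
  then show ?thesis
    using assms(1,2) eq by blast
qed

lemma occ_surj:
  assumes "sum f \<Sigma> = k"
  obtains p where "p + k \<le> length w" "\<And>x. x \<in> \<Sigma> \<Longrightarrow> occ x p = f x"
proof -
  have "sum_list (map f (sorted_list_of_set \<Sigma>)) = k"
    using assms finite_alphabet by (simp add: sum_list_distinct_conv_sum_set)
  then obtain p where "p + k \<le> length w"
    "parikh_vector \<Sigma> (take k (drop p w)) = map f (sorted_list_of_set \<Sigma>)"
    using PdB unfolding PdB_string_def
    by (metis length_map length_sorted_list_of_set)
  then show thesis
    using that finite_alphabet by (auto simp: parikh_vector_def occ_def)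
qed

lemma occ_Suc:
  "p + k < length w \<Longrightarrow> occ x (Suc p) + of_bool (w ! p = x) = occ x p + of_bool (w ! (p + k) = x)"
  unfolding occ_def by (rule count_list_window_Suc)

text \<open>Otherwise two consecutive windows would have the same Parikh vector.\<close>

lemma nth_neq_nth_add:
  assumes "p + k < length w"
  shows "w ! p \<noteq> w ! (p + k)"
proof
  assume "w ! p = w ! (p + k)"
  then have "occ x (Suc p) = occ x p" for x
    using occ_Suc [OF assms, of x] by simp
  then have "Suc p = p"
    using assms by (rule_tac occ_inj) auto
  then show False by simp
qed

section \<open>Arms at a corner\<close>

lemma nth_in_corner:
  assumes "p + k \<le> length w" "occ x p = k" "p \<le> q" "q < p + k"
  shows "w ! q = x"
proof -
  have "set (take k (drop p w)) \<subseteq> {x}"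
    using assms(1,2) count_list_eq_length_iff [of "take k (drop p w)" x] by (simp add: occ_def)
  moreover have "take k (drop p w) ! (q - p) \<in> set (take k (drop p w))"
    using assms by (intro nth_mem) simp
  ultimately show ?thesis
    using assms by auto
qed

text \<open>The departing letter belongs to the block of \<open>x\<close>, so the arriving one must
  differ from it. Hence \<open>x\<close> is only lost along the arm, and no other letter is.\<close>

lemma corner_right_step:
  assumes "p + k \<le> length w" "occ x p = k" "t < k" "p + t + k < length w"
  shows "w ! (p + t) = x" "w ! (p + t + k) \<noteq> x"
  using nth_in_corner [OF assms(1,2), of "p + t"] nth_neq_nth_add [OF assms(4)] assms(3) by auto

lemma corner_left_step:
  assumes "p + k \<le> length w" "occ x p = k" "t < k" "t < p"
  shows "w ! (p - Suc t + k) = x" "w ! (p - Suc t) \<noteq> x"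
  using nth_in_corner [OF assms(1,2), of "p - Suc t + k"] nth_neq_nth_add [of "p - Suc t"] assms
  by auto

lemma occ_right_arm:
  assumes "p + k \<le> length w" "occ x p = k"
  shows "t \<le> k \<Longrightarrow> p + t + k \<le> length w \<Longrightarrow> occ x (p + t) = k - t"
proof (induction t)
  case (Suc t)
  then show ?case
    using occ_Suc [of "p + t" x] corner_right_step [OF assms, of t] by simp
qed (use assms in simp)

lemma occ_left_arm:
  assumes "p + k \<le> length w" "occ x p = k"
  shows "t \<le> k \<Longrightarrow> t \<le> p \<Longrightarrow> occ x (p - t) = k - t"
proof (induction t)
  case (Suc t)
  then show ?case
    using occ_Suc [of "p - Suc t" x] corner_left_step [OF assms, of t] assms(1)
    by (cases "p - Suc t + k < length w") (auto simp: Suc_diff_Suc)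
qed (use assms in simp)

lemma occ_right_arm_other:
  assumes "p + k \<le> length w" "occ x p = k" "y \<noteq> x" "t < k" "p + t + k < length w"
  shows "occ y (p + Suc t) = occ y (p + t) \<or> occ y (p + Suc t) = Suc (occ y (p + t))"
  using occ_Suc [of "p + t" y] corner_right_step [OF assms(1,2,4,5)] assms(3,5)
  by (auto split: if_splits)

lemma occ_left_arm_other:
  assumes "p + k \<le> length w" "occ x p = k" "y \<noteq> x" "t < k" "t < p"
  shows "occ y (p - Suc t) = occ y (p - t) \<or> occ y (p - Suc t) = Suc (occ y (p - t))"
  using occ_Suc [of "p - Suc t" y] corner_left_step [OF assms(1,2,4,5)] assms(1,3,5)
  by (cases "w ! (p - Suc t) = y") (auto simp: Suc_diff_Suc)

section \<open>Three corners visited in a fixed order\<close>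

context
  fixes a b c :: 'a and i j l :: nat
  assumes \<Sigma>: "\<Sigma> = {a, b, c}" and neq: "a \<noteq> b" "a \<noteq> c" "b \<noteq> c" and k4: "4 \<le> k"
    and valid: "i + k \<le> length w" "j + k \<le> length w" "l + k \<le> length w"
    and corners: "occ a i = k" "occ b j = k" "occ c l = k"
    and order: "i < j" "j < l"
begin

lemma occ_total: "p + k \<le> length w \<Longrightarrow> occ a p + occ b p + occ c p = k"
  using sum_occ [of p] neq by (simp add: \<Sigma> add.assoc)

lemma occ_eqI:
  assumes "p + k \<le> length w" "q + k \<le> length w" "occ a p = occ a q" "occ c p = occ c q"
  shows "p = q"
proof (rule occ_inj)
  show "occ x p = occ x q" if "x \<in> \<Sigma>" for x
    using that occ_total [OF assms(1)] occ_total [OF assms(2)] assms(3,4) \<Sigma> by auto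
qed (fact assms)+

text \<open>Fewer than \<open>k\<close> steps after a corner its letter is still in the window, so
  no other corner can be visited then.\<close>

lemma corner_blocks_disjoint: "i + k \<le> j" "j + k \<le> l"
proof -
  have "occ a j = 0" "occ b l = 0"
    using occ_total valid(2,3) corners(2,3) by fastforce+
  then show "i + k \<le> j" "j + k \<le> l"
    using occ_right_arm [OF valid(1) corners(1), of "j - i"]
      occ_right_arm [OF valid(2) corners(2), of "l - j"] valid order
    by (simp_all, linarith+)
qed

lemma corner_blocks_adjacent: "j = i + k" "l = i + 2 * k"
proof -
  have li: "i + 2 * k \<le> l"
    using corner_blocks_disjoint by simp
  have "occ b i = 0" "occ b l = 0"
    using occ_total valid(1,3) corners(1,3) by fastforce+
  moreover have "occ b (i + Suc t) = occ b (i + t) \<or> occ b (i + Suc t) = Suc (occ b (i + t))"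
    if "t < k" for t
    using that li valid neq by (intro occ_right_arm_other [OF valid(1) corners(1)]) auto
  moreover have "occ b (l - Suc s) = occ b (l - s) \<or> occ b (l - Suc s) = Suc (occ b (l - s))"
    if "s < k" for s
    using that li neq by (intro occ_left_arm_other [OF valid(3) corners(3)]) auto
  ultimately obtain t where t: "t \<le> k" "occ b (i + t) \<le> t"
    "occ b (l - (k + occ b (i + t) - t)) = occ b (i + t)"
    using monotone_arms_cross [of "\<lambda>t. occ b (i + t)" "\<lambda>s. occ b (l - s)" k] by force
  \<comment> \<open>For this \<open>s\<close> the \<open>c\<close>-entry \<open>k - s\<close> at
    \<open>l - s\<close> equals the \<open>c\<close>-entry \<open>t - occ b (i + t)\<close> at
    \<open>i + t\<close>.\<close>
  define s where "s = k + occ b (i + t) - t"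
  have s: "s \<le> k" "s \<le> l"
    using t li by (auto simp: s_def)
  have v: "i + t + k \<le> length w" "l - s + k \<le> length w"
    using t li valid by auto
  have "i + t = l - s"
  proof (rule occ_eqI [OF v])
    have "occ a (i + t) = k - t" "occ c (l - s) = k - s"
      using occ_right_arm [OF valid(1) corners(1) t(1) v(1)]
        occ_left_arm [OF valid(3) corners(3) s] by auto
    moreover have "occ b (l - s) = occ b (i + t)"
      using t(3) by (simp add: s_def)
    moreover have "s + t = k + occ b (i + t)"
      using t by (simp add: s_def)
    ultimately show "occ a (i + t) = occ a (l - s)" "occ c (i + t) = occ c (l - s)"
      using occ_total [OF v(1)] occ_total [OF v(2)] t(1) s(1) by linarith+
  qed
  \<comment> \<open>The meeting time is within \<open>k\<close> steps of both \<open>i\<close> and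
    \<open>l\<close>, which leaves no gap between the disjoint blocks.\<close>
  then show "j = i + k" "l = i + 2 * k"
    using li s t corner_blocks_disjoint by linarith+
qed

text \<open>The arm leaving the corner of \<open>a\<close> is also the arm entering that of
  \<open>b\<close>, so these two entries already sum to \<open>k\<close>.\<close>

lemma occ_side_ab:
  assumes "t \<le> k"
  shows "occ a (i + t) = k - t" "occ c (i + t) = 0"
proof -
  have v: "i + t + k \<le> length w"
    using assms valid corner_blocks_adjacent by simp
  have "occ b (i + t) = t"
    using occ_left_arm [OF valid(2) corners(2), of "k - t"] assms corner_blocks_adjacent by simp
  then show "occ a (i + t) = k - t" "occ c (i + t) = 0"
    using occ_right_arm [OF valid(1) corners(1) assms v] occ_total [OF v] by auto
qed

lemma occ_side_bc:
  assumes "t \<le> k"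
  shows "occ a (j + t) = 0" "occ c (j + t) = t"
proof -
  have v: "j + t + k \<le> length w"
    using assms valid corner_blocks_adjacent by simp
  show "occ c (j + t) = t"
    using occ_left_arm [OF valid(3) corners(3), of "k - t"] assms corner_blocks_adjacent
    by (simp add: mult_2 add.assoc)
  then show "occ a (j + t) = 0"
    using occ_right_arm [OF valid(2) corners(2) assms v] occ_total [OF v] assms by auto
qed

text \<open>A complete arm would start at a point without \<open>a\<close>, but all those points are
  visited between \<open>j\<close> and \<open>l\<close>.\<close>

lemma left_end: "i < k"
proof (rule ccontr)
  assume "\<not> i < k"
  then have v: "i - k + k \<le> length w" and a: "occ a (i - k) = 0"
    using valid occ_left_arm [OF valid(1) corners(1), of k] by auto
  define t where "t = occ c (i - k)"
  have t: "t \<le> k"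
    using occ_total [OF v] by (simp add: t_def)
  have "i - k = j + t"
    using v a t valid corner_blocks_adjacent occ_side_bc [OF t]
    by (rule_tac occ_eqI) (auto simp: t_def)
  then show False
    using corner_blocks_adjacent k4 by simp
qed

lemma right_end: "length w < l + 2 * k"
proof (rule ccontr)
  assume "\<not> length w < l + 2 * k"
  then have v: "l + k + k \<le> length w" and c: "occ c (l + k) = 0"
    using occ_right_arm [OF valid(3) corners(3), of k] by auto
  define t where "t = k - occ a (l + k)"
  have t: "t \<le> k" "k - t = occ a (l + k)"
    using occ_total [OF v] by (auto simp: t_def)
  have "l + k = i + t"
    using v c t valid corner_blocks_adjacent occ_side_ab [OF t(1)]
    by (rule_tac occ_eqI) auto
  then show False
    using corner_blocks_adjacent t k4 by simp
qed

text \<open>Between \<open>i\<close> and \<open>l\<close> the walk stays on the two sides where the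
  \<open>a\<close>- or the \<open>c\<close>-entry vanishes. On the incomplete arms outside, one
  entry determines the position.\<close>

lemma inner_point_position:
  assumes "p + k \<le> length w" "0 < occ a p" "0 < occ c p"
  shows "p + k = i + occ a p \<and> p < i \<or> p + occ c p = l + k \<and> l < p"
proof -
  consider "p < i" | "i \<le> p" "p \<le> j" | "j \<le> p" "p \<le> l" | "l < p"
    by linarith
  then show ?thesis
  proof cases
    case 1
    then show ?thesis
      using occ_left_arm [OF valid(1) corners(1), of "i - p"] left_end by simp
  next
    case 2
    then have "p - i \<le> k"
      using corner_blocks_adjacent by linarith
    then show ?thesis
      using occ_side_ab(2) [of "p - i"] assms 2 by simp
  next
    case 3
    then have "p - j \<le> k"
      using corner_blocks_adjacent by linarith
    then show ?thesis
      using occ_side_bc(1) [of "p - j"] assms 3 by simp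
  next
    case 4
    then show ?thesis
      using occ_right_arm [OF valid(3) corners(3), of "p - l"] right_end assms(1) by simp
  qed
qed

lemma inner_point:
  assumes "x \<in> {1, 2}" "y \<in> {1, 2}"
  obtains p where "p + k \<le> length w" "occ a p = x" "occ c p = y"
    "p + k = i + x \<and> p < i \<or> p + y = l + k \<and> l < p"
proof -
  \<comment> \<open>As \<open>4 \<le> k\<close>, the subtraction in the \<open>b\<close>-entry is
    not truncated, even for \<open>x = y = 2\<close>.\<close>
  have "sum ((\<lambda>_. 0)(a := x, b := k - x - y, c := y)) \<Sigma> = k"
    using assms k4 neq by (auto simp: \<Sigma>)
  then obtain p where "p + k \<le> length w"
    "\<And>z. z \<in> \<Sigma> \<Longrightarrow> occ z p = ((\<lambda>_. 0)(a := x, b := k - x - y, c := y)) z"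
    using occ_surj by blast
  then have "p + k \<le> length w" "occ a p = x" "occ c p = y"
    using neq \<Sigma> by auto
  then show thesis
    using that inner_point_position [of p] assms by auto
qed

lemma ordered_corners_impossible: False
proof -
  obtain p11 where p11: "p11 + k \<le> length w" "occ a p11 = 1" "occ c p11 = 1"
    "p11 + k = i + 1 \<and> p11 < i \<or> p11 + 1 = l + k \<and> l < p11"
    by (rule inner_point [of 1 1]) auto
  obtain p12 where p12: "occ a p12 = 1" "occ c p12 = 2"
    "p12 + k = i + 1 \<or> p12 + 2 = l + k"
    by (rule inner_point [of 1 2]) auto
  obtain p21 where p21: "occ a p21 = 2" "occ c p21 = 1"
    "p21 + k = i + 2 \<or> p21 + 1 = l + k"
    by (rule inner_point [of 2 1]) auto
  obtain p22 where p22: "p22 + k \<le> length w" "occ a p22 = 2" "occ c p22 = 2"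
    "p22 + k = i + 2 \<and> p22 < i \<or> p22 + 2 = l + k \<and> l < p22"
    by (rule inner_point [of 2 2]) auto
  from p11(4) show False
  proof
    assume left: "p11 + k = i + 1 \<and> p11 < i"
    \<comment> \<open>Each arm holds one position per value of its entry. So \<open>p12\<close> is
      forced to the right, then \<open>p22\<close> to the left, one step nearer to the corner than
      \<open>p11\<close>; but the \<open>c\<close>-entry cannot fall from 2 to 1 away from the
      corner.\<close>
    have "p12 \<noteq> p11" "p12 \<noteq> p22"
      using p11 p12 p22 by auto
    then have "p22 + k = i + 2 \<and> p22 < i"
      using left p12 p22 by auto
    then have "i - Suc (k - 2) = p11" "i - (k - 2) = p22" "k - 2 < i"
      using left k4 by auto
    then show False
      using occ_left_arm_other [OF valid(1) corners(1), of c "k - 2"] neq k4 p11 p22 by auto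
  next
    assume right: "p11 + 1 = l + k \<and> l < p11"
    \<comment> \<open>The mirror image, with \<open>p21\<close> and the
      \<open>a\<close>-entry.\<close>
    have "p21 \<noteq> p11" "p21 \<noteq> p22"
      using p11 p21 p22 by auto
    then have "p22 + 2 = l + k \<and> l < p22"
      using right p21 p22 by auto
    then have "l + Suc (k - 2) = p11" "l + (k - 2) = p22"
      using right k4 by auto
    then show False
      using occ_right_arm_other [OF valid(3) corners(3), of a "k - 2"] neq k4 p11 p22 by auto
  qed
qed

end

section \<open>Reduction to ordered corners by renaming letters\<close>

lemma corner_exists:
  assumes "x \<in> \<Sigma>"
  obtains p where "p + k \<le> length w" "occ x p = k"
proof -
  have "(\<Sum>y\<in>\<Sigma>. if y = x then k else 0) = k"
    using assms finite_alphabet by simp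
  then show thesis
    using that assms by (rule_tac occ_surj) auto
qed

lemma corner_letter_unique:
  assumes "p + k \<le> length w" "occ x p = k" "occ y p = k" "0 < k"
  shows "x = y"
  using nth_in_corner [of p x p] nth_in_corner [of p y p] assms by auto

lemma three_letters_impossible:
  assumes "card \<Sigma> = 3" "4 \<le> k"
  shows False
proof -
  obtain a b c where \<Sigma>: "\<Sigma> = {a, b, c}" and neq: "a \<noteq> b" "a \<noteq> c" "b \<noteq> c"
    using assms(1) by (auto simp: card_3_iff)
  obtain i where i: "i + k \<le> length w" "occ a i = k"
    using corner_exists [of a] \<Sigma> by auto
  obtain j where j: "j + k \<le> length w" "occ b j = k"
    using corner_exists [of b] \<Sigma> by auto
  obtain l where l: "l + k \<le> length w" "occ c l = k"
    using corner_exists [of c] \<Sigma> by auto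
  have "i \<noteq> j" "i \<noteq> l" "j \<noteq> l"
    using corner_letter_unique i j l neq assms(2) by auto
  then consider "i < j" "j < l" | "i < l" "l < j" | "j < i" "i < l" | "j < l" "l < i"
    | "l < i" "i < j" | "l < j" "j < i"
    by linarith
  moreover have "\<Sigma> = {a, c, b}" "\<Sigma> = {b, a, c}" "\<Sigma> = {b, c, a}" "\<Sigma> = {c, a, b}" "\<Sigma> = {c, b, a}"
    using \<Sigma> by auto
  ultimately show False
    using ordered_corners_impossible i j l neq neq [symmetric] \<Sigma> assms(2)
    by cases metis+
qed

end

theorem theorem5:
  fixes \<Sigma> :: "'a::linorder set" and k :: nat
  assumes "finite \<Sigma>" and "card \<Sigma> = 3" and "k \<ge> 4"
  shows "\<nexists>w. PdB_string k \<Sigma> w"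
  using assms parikh_de_bruijn_string.three_letters_impossible parikh_de_bruijn_string.intro
  by blast

end
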